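(* Let $\mathcal{M}=\{M_1,M_2\}$ be a binary MMDP, let $\boldsymbol\pi$ be a (history-dependent randomized) policy, and let $$B(t,\boldsymbol\pi)=\sum_{h_t\in\mathcal{H}_t}\sqrt{\mathbb{P}_1^{\boldsymbol\pi}(h_t)\,\mathbb{P}_2^{\boldsymbol\pi}(h_t)},\qquad t\in\mathbb{N}_{\ge0}.$$ Then: (i) $B(t,\boldsymbol\pi)$ is monotonically non-increasing in $t$, i.e. $B(t+1,\boldsymbol\pi)\le B(t,\boldsymbol\pi)$ for all $t\in\mathbb{N}_{\ge0}$; (ii) the limit $\lim_{t\to\infty}B(t,\boldsymbol\pi)$ exists.
   Context: An MDP is $M=(\mathcal{S},\mathcal{A},\delta,s_{\mathrm{init}})$ with a finite state set $\mathcal{S}$, finite nonempty action sets $\mathcal{A}_s$ ($s\in\mathcal{S}$), $\mathcal{A}=\cup_s\mathcal{A}_s$, a kernel $\delta(s'|s,a)\in[0,1]$ for $s,s'\in\mathcal{S}$, $a\in\mathcal{A}_s$, with $\sum_{s'}\delta(s'|s,a)=1$, and an initial state $s_{\mathrm{init}}$. A history at step $t$ is $h_t=(s_0,a_0,\dots,s_t)$ with $s_0=s_{\mathrm{init}}$, $a_\tau\in\mathcal{A}_{s_\tau}$, $\delta(s_{\tau+1}|s_\tau,a_\tau)>0$. A binary MMDP $\{M_1,M_2\}$ is a pair of MDPs $M_i=(\mathcal{S},\mathcal{A},\delta_i,s_{\mathrm{init}})$ with the same states, available actions and initial state; $\mathcal{H}_t$ is the union of the sets of step-$t$ histories of $M_1$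 and $M_2$. A policy $\boldsymbol{\pi}=(\pi_0,\pi_1,\dots)$ assigns to each $h_t\in\mathcal{H}_t$ ending in $s_t$ a probability distribution $\pi_t(\cdot|h_t)$ on $\mathcal{A}_{s_t}$. $\mathbb{P}_i^{\boldsymbol\pi}(h_t)$ is the probability that $h_t$ occurs in $M_i$ under $\boldsymbol\pi$, i.e. $\prod_{\tau=0}^{t-1}\pi_\tau(a_\tau|h_\tau)\delta_i(s_{\tau+1}|s_\tau,a_\tau)$, where $h_\tau$ is the step-$\tau$ prefix of $h_t$. *)

theory Defs
  imports "HOL-Probability.Probability_Mass_Function"
begin

record ('s, 'a) mdp =
  states :: "'s set"
  actions :: "'s \<Rightarrow> 'a set"
  kernel :: "'s \<Rightarrow> 'a \<Rightarrow> 's pmf"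
  s_init :: 's

text \<open>\<open>pmf (kernel M s a) s'\<close> is the probability of moving from \<open>s\<close> to \<open>s'\<close> under action \<open>a\<close>.
  The fields \<open>actions\<close> and \<open>kernel\<close> are total functions; only their values at states \<open>s\<close> of \<open>M\<close>
  and actions available in \<open>s\<close> are meaningful.\<close>

definition is_mdp :: "('s, 'a) mdp \<Rightarrow> bool" where
  "is_mdp M \<longleftrightarrow>
     finite (states M) \<and>
     (\<forall>s\<in>states M. finite (actions M s) \<and> actions M s \<noteq> {}) \<and>
     (\<forall>s\<in>states M. \<forall>a\<in>actions M s. set_pmf (kernel M s a) \<subseteq> states M) \<and>
     s_init M \<in> states M"

definition binary_mmdp :: "('s, 'a) mdp \<Rightarrow> ('s, 'a) mdp \<Rightarrow> bool" where
  "binary_mmdp M\<^sub>1 M\<^sub>2 \<longleftrightarrow>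
     is_mdp M\<^sub>1 \<and> is_mdp M\<^sub>2 \<and>
     states M\<^sub>1 = states M\<^sub>2 \<and> s_init M\<^sub>1 = s_init M\<^sub>2 \<and>
     (\<forall>s\<in>states M\<^sub>1. actions M\<^sub>1 s = actions M\<^sub>2 s)"

text \<open>The history \<open>(s\<^sub>0, a\<^sub>0, s\<^sub>1, \<dots>, a\<^sub>t\<^sub>-\<^sub>1, s\<^sub>t)\<close> is encoded as the pair of the list
  \<open>[s\<^sub>0, \<dots>, s\<^sub>t]\<close> of its states and the list \<open>[a\<^sub>0, \<dots>, a\<^sub>t\<^sub>-\<^sub>1]\<close> of its actions.\<close>

type_synonym ('s, 'a) history = "'s list \<times> 'a list"

definition histories :: "('s, 'a) mdp \<Rightarrow> nat \<Rightarrow> ('s, 'a) history set" where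
  "histories M t = {(ss, as).
     length ss = Suc t \<and> length as = t \<and> set ss \<subseteq> states M \<and> ss ! 0 = s_init M \<and>
     (\<forall>\<tau><t. as ! \<tau> \<in> actions M (ss ! \<tau>) \<and>
            pmf (kernel M (ss ! \<tau>) (as ! \<tau>)) (ss ! Suc \<tau>) > 0)}"

definition mmdp_histories ::
    "('s, 'a) mdp \<Rightarrow> ('s, 'a) mdp \<Rightarrow> nat \<Rightarrow> ('s, 'a) history set" where
  "mmdp_histories M\<^sub>1 M\<^sub>2 t = histories M\<^sub>1 t \<union> histories M\<^sub>2 t"

definition history_prefix :: "nat \<Rightarrow> ('s, 'a) history \<Rightarrow> ('s, 'a) history" where
  "history_prefix \<tau> h = (take (Suc \<tau>) (fst h), take \<tau> (snd h))"

type_synonym ('s, 'a) policy = "nat \<Rightarrow> ('s, 'a) history \<Rightarrow> 'a pmf"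

text \<open>By \<open>binary_mmdp\<close>, \<open>M\<^sub>2\<close> has the same available actions as \<open>M\<^sub>1\<close>. A policy is unconstrained
  outside the histories of the MMDP.\<close>

definition is_policy ::
    "('s, 'a) mdp \<Rightarrow> ('s, 'a) mdp \<Rightarrow> ('s, 'a) policy \<Rightarrow> bool" where
  "is_policy M\<^sub>1 M\<^sub>2 \<pi> \<longleftrightarrow>
     (\<forall>t. \<forall>h\<in>mmdp_histories M\<^sub>1 M\<^sub>2 t. set_pmf (\<pi> t h) \<subseteq> actions M\<^sub>1 (last (fst h)))"

definition history_prob ::
    "('s, 'a) mdp \<Rightarrow> ('s, 'a) policy \<Rightarrow> nat \<Rightarrow> ('s, 'a) history \<Rightarrow> real" where
  "history_prob M \<pi> t h =
     (\<Prod>\<tau><t. pmf (\<pi> \<tau> (history_prefix \<tau> h)) (snd h ! \<tau>) *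
            pmf (kernel M (fst h ! \<tau>) (snd h ! \<tau>)) (fst h ! Suc \<tau>))"

definition bhattacharyya ::
    "('s, 'a) mdp \<Rightarrow> ('s, 'a) mdp \<Rightarrow> ('s, 'a) policy \<Rightarrow> nat \<Rightarrow> real" where
  "bhattacharyya M\<^sub>1 M\<^sub>2 \<pi> t =
     (\<Sum>h\<in>mmdp_histories M\<^sub>1 M\<^sub>2 t. sqrt (history_prob M\<^sub>1 \<pi> t h * history_prob M\<^sub>2 \<pi> t h))"

text \<open>The sum in \<open>bhattacharyya\<close> ranges over a finite set, so it never takes the default value
  of \<open>sum\<close> on infinite sets.\<close>

lemma finite_histories:
  assumes "is_mdp M"
  shows "finite (histories M t)"
proof -
  have "as ! i \<in> (\<Union>s\<in>states M. actions M s)"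
    if "(ss, as) \<in> histories M t" "i < t" for ss as i
  proof -
    from that have "ss ! i \<in> states M" "as ! i \<in> actions M (ss ! i)"
      by (auto simp: histories_def subset_iff)
    then show ?thesis by blast
  qed
  then have "histories M t \<subseteq>
      {ss. set ss \<subseteq> states M \<and> length ss = Suc t} \<times>
      {as. set as \<subseteq> (\<Union>s\<in>states M. actions M s) \<and> length as = t}"
    by (fastforce simp: histories_def in_set_conv_nth)
  moreover have "finite (\<Union>s\<in>states M. actions M s)" "finite (states M)"
    using assms by (auto simp: is_mdp_def)
  ultimately show ?thesis
    by (elim finite_subset) (intro finite_cartesian_product finite_lists_length_eq)
qed

lemma finite_mmdp_histories:
  assumes "binary_mmdp M\<^sub>1 M\<^sub>2"
  shows "finite (mmdp_histories M\<^sub>1 M\<^sub>2 t)"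
  using assms by (simp add: binary_mmdp_def mmdp_histories_def finite_histories)

end

theory Submission
  imports Defs
begin

text \<open>
  Appending an action \<open>a\<close> and a state \<open>s\<close> to a history \<open>h\<close> multiplies its probability under
  either model by \<open>\<pi>(a | h) \<delta>\<^sub>i(s | last h, a)\<close>. The policy factor is the same in both models,
  so it comes out of the square root, and the extensions of \<open>h\<close> contribute to the coefficient
  at the next step the amount
  \<open>\<surd>(P\<^sub>1(h) P\<^sub>2(h)) \<Sum>\<^sub>a \<pi>(a | h) \<Sum>\<^sub>s \<surd>(\<delta>\<^sub>1(s | last h, a) \<delta>\<^sub>2(s | last h, a))\<close>.
  The inner sum is the Bhattacharyya coefficient of two distributions, which is at most 1
  (\<open>sum_sqrt_pmf_le_1\<close>), and so is the sum of the policy factors. As every history at step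
  \<open>t + 1\<close> extends one at step \<open>t\<close>, the coefficient cannot grow. It is nonnegative, hence it
  converges.
\<close>

text \<open>By the inequality of arithmetic and geometric means, the coefficient is bounded by the
  average of the masses that the two distributions give to the set.\<close>

lemma sum_sqrt_pmf_le_1:
  assumes "finite S"
  shows "(\<Sum>s\<in>S. sqrt (pmf p s * pmf q s)) \<le> 1"
proof -
  have "(\<Sum>s\<in>S. sqrt (pmf p s * pmf q s)) \<le> (\<Sum>s\<in>S. (pmf p s + pmf q s) / 2)"
    by (intro sum_mono arith_geo_mean_sqrt) simp_all
  also have "\<dots> = (measure p S + measure q S) / 2"
    using assms by (simp add: measure_measure_pmf_finite sum.distrib flip: sum_divide_distrib)
  also have "\<dots> \<le> 1"
    using add_mono[OF measure_pmf.prob_le_1[of p S] measure_pmf.prob_le_1[of q S]] by simp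
  finally show ?thesis .
qed

definition extend_history :: "('s, 'a) history \<Rightarrow> 'a \<Rightarrow> 's \<Rightarrow> ('s, 'a) history" where
  "extend_history h a s = (fst h @ [s], snd h @ [a])"

lemma inj_extend_history: "inj (\<lambda>(h, a, s). extend_history h a s)"
  by (auto simp: inj_def extend_history_def prod_eq_iff)

lemma history_prob_nonneg: "history_prob M \<pi> t h \<ge> 0"
  unfolding history_prob_def by (intro prod_nonneg) simp

lemma history_prob_extend:
  assumes "length (fst h) = Suc t" "length (snd h) = t"
  shows "history_prob M \<pi> (Suc t) (extend_history h a s) =
    history_prob M \<pi> t h * (pmf (\<pi> t h) a * pmf (kernel M (last (fst h)) a) s)"
proof -
  let ?h' = "extend_history h a s"
  have "history_prefix \<tau> ?h' = history_prefix \<tau> h"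
    "snd ?h' ! \<tau> = snd h ! \<tau>" "fst ?h' ! \<tau> = fst h ! \<tau>" "fst ?h' ! Suc \<tau> = fst h ! Suc \<tau>"
    if "\<tau> < t" for \<tau>
    using that assms by (auto simp: history_prefix_def extend_history_def nth_append)
  then have "history_prob M \<pi> t ?h' = history_prob M \<pi> t h"
    unfolding history_prob_def by (intro prod.cong) auto
  moreover have "history_prefix t ?h' = h" "snd ?h' ! t = a" "fst ?h' ! Suc t = s"
    using assms by (auto simp: history_prefix_def extend_history_def prod_eq_iff nth_append)
  moreover have "fst ?h' ! t = last (fst h)"
    using assms by (cases "fst h" rule: rev_cases) (auto simp: extend_history_def nth_append)
  ultimately show ?thesis
    by (simp add: history_prob_def)
qed

lemma histories_SucE:
  assumes "h' \<in> histories M (Suc t)"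
  obtains h a s where "h' = extend_history h a s" "h \<in> histories M t"
    "a \<in> (\<Union>s\<in>states M. actions M s)" "s \<in> states M"
proof -
  obtain ss as s a where h': "h' = (ss @ [s], as @ [a])"
    and len: "length ss = Suc t" "length as = t"
  proof -
    obtain ss' as' where h'': "h' = (ss', as')" "length ss' = Suc (Suc t)" "length as' = Suc t"
      using assms by (auto simp: histories_def)
    then show thesis
      using that[of "butlast ss'" "last ss'" "butlast as'" "last as'"]
      by (metis append_butlast_last_id diff_Suc_1 length_butlast length_0_conv nat.distinct(1))
  qed
  have step: "(as @ [a]) ! \<tau> \<in> actions M ((ss @ [s]) ! \<tau>) \<and>
      pmf (kernel M ((ss @ [s]) ! \<tau>) ((as @ [a]) ! \<tau>)) ((ss @ [s]) ! Suc \<tau>) > 0"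
    if "\<tau> < Suc t" for \<tau>
    using assms that unfolding h' histories_def by blast
  have init: "set ss \<subseteq> states M" "s \<in> states M" "ss ! 0 = s_init M"
    using assms len by (auto simp: h' histories_def nth_append)
  have "as ! \<tau> \<in> actions M (ss ! \<tau>) \<and> pmf (kernel M (ss ! \<tau>) (as ! \<tau>)) (ss ! Suc \<tau>) > 0"
    if "\<tau> < t" for \<tau>
    using step[of \<tau>] that len by (simp add: nth_append)
  then have "(ss, as) \<in> histories M t"
    using len init by (simp add: histories_def)
  moreover have "a \<in> actions M (ss ! t)" "ss ! t \<in> states M"
    using step[of t] len init(1) by (auto simp: nth_append subset_iff)
  ultimately show ?thesis
    using that[of "(ss, as)" a s] init by (auto simp: h' extend_history_def)
qed

lemma mmdp_histories_Suc_subset: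
  assumes "binary_mmdp M\<^sub>1 M\<^sub>2"
  shows "mmdp_histories M\<^sub>1 M\<^sub>2 (Suc t) \<subseteq> (\<lambda>(h, a, s). extend_history h a s) `
    (mmdp_histories M\<^sub>1 M\<^sub>2 t \<times> (\<Union>s\<in>states M\<^sub>1. actions M\<^sub>1 s) \<times> states M\<^sub>1)"
proof
  fix h' assume "h' \<in> mmdp_histories M\<^sub>1 M\<^sub>2 (Suc t)"
  then obtain M where M: "M = M\<^sub>1 \<or> M = M\<^sub>2" "h' \<in> histories M (Suc t)"
    by (auto simp: mmdp_histories_def)
  have "states M = states M\<^sub>1" "(\<Union>s\<in>states M. actions M s) = (\<Union>s\<in>states M\<^sub>1. actions M\<^sub>1 s)"
    using assms M(1) by (auto simp: binary_mmdp_def)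
  moreover obtain h a s where "h' = extend_history h a s" "h \<in> histories M t"
    "a \<in> (\<Union>s\<in>states M. actions M s)" "s \<in> states M"
    using M(2) by (rule histories_SucE)
  moreover from this(2) M(1) have "h \<in> mmdp_histories M\<^sub>1 M\<^sub>2 t"
    by (auto simp: mmdp_histories_def)
  ultimately show "h' \<in> (\<lambda>(h, a, s). extend_history h a s) `
      (mmdp_histories M\<^sub>1 M\<^sub>2 t \<times> (\<Union>s\<in>states M\<^sub>1. actions M\<^sub>1 s) \<times> states M\<^sub>1)"
    by (intro image_eqI[of _ _ "(h, a, s)"]) simp_all
qed

text \<open>The data processing inequality for one step of interaction: refining a history by its
  next action and state can only make the two models easier to tell apart.\<close>

lemma sum_extensions_le:
  assumes "finite A" "finite S" "length (fst h) = Suc t" "length (snd h) = t"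
  shows "(\<Sum>a\<in>A. \<Sum>s\<in>S. sqrt (history_prob M\<^sub>1 \<pi> (Suc t) (extend_history h a s) *
                               history_prob M\<^sub>2 \<pi> (Suc t) (extend_history h a s)))
         \<le> sqrt (history_prob M\<^sub>1 \<pi> t h * history_prob M\<^sub>2 \<pi> t h)"
proof -
  define b where "b = sqrt (history_prob M\<^sub>1 \<pi> t h * history_prob M\<^sub>2 \<pi> t h)"
  define \<delta>\<^sub>1 \<delta>\<^sub>2 where "\<delta>\<^sub>1 = kernel M\<^sub>1 (last (fst h))" and "\<delta>\<^sub>2 = kernel M\<^sub>2 (last (fst h))"
  have b: "b \<ge> 0"
    by (simp add: b_def history_prob_nonneg)
  have "sqrt (history_prob M\<^sub>1 \<pi> (Suc t) (extend_history h a s) *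
              history_prob M\<^sub>2 \<pi> (Suc t) (extend_history h a s)) =
        b * (pmf (\<pi> t h) a * sqrt (pmf (\<delta>\<^sub>1 a) s * pmf (\<delta>\<^sub>2 a) s))" for a s
    by (simp add: history_prob_extend[OF assms(3,4)] b_def \<delta>\<^sub>1_def \<delta>\<^sub>2_def real_sqrt_mult)
  then have "(\<Sum>a\<in>A. \<Sum>s\<in>S. sqrt (history_prob M\<^sub>1 \<pi> (Suc t) (extend_history h a s) *
                               history_prob M\<^sub>2 \<pi> (Suc t) (extend_history h a s))) =
      b * (\<Sum>a\<in>A. pmf (\<pi> t h) a * (\<Sum>s\<in>S. sqrt (pmf (\<delta>\<^sub>1 a) s * pmf (\<delta>\<^sub>2 a) s)))"
    by (simp add: sum_distrib_left)
  also have "\<dots> \<le> b * (\<Sum>a\<in>A. pmf (\<pi> t h) a)"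
    using b sum_sqrt_pmf_le_1[OF assms(2)]
    by (intro mult_left_mono sum_mono mult_left_le) simp_all
  also have "(\<Sum>a\<in>A. pmf (\<pi> t h) a) = measure (\<pi> t h) A"
    using assms(1) by (simp add: measure_measure_pmf_finite)
  also have "b * measure (\<pi> t h) A \<le> b"
    using b by (intro mult_left_le) simp_all
  finally show ?thesis
    by (simp add: b_def)
qed

lemma bhattacharyya_Suc_le:
  assumes "binary_mmdp M\<^sub>1 M\<^sub>2"
  shows "bhattacharyya M\<^sub>1 M\<^sub>2 \<pi> (Suc t) \<le> bhattacharyya M\<^sub>1 M\<^sub>2 \<pi> t"
proof -
  let ?H = "mmdp_histories M\<^sub>1 M\<^sub>2" and ?S = "states M\<^sub>1"
  let ?A = "\<Union>s\<in>?S. actions M\<^sub>1 s"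
  let ?E = "\<lambda>(h, a, s). extend_history h a s"
  let ?f = "\<lambda>t h. sqrt (history_prob M\<^sub>1 \<pi> t h * history_prob M\<^sub>2 \<pi> t h)"
  have fin: "finite (?H t)" "finite ?A" "finite ?S"
    using assms finite_mmdp_histories[OF assms] by (auto simp: binary_mmdp_def is_mdp_def)
  have "bhattacharyya M\<^sub>1 M\<^sub>2 \<pi> (Suc t) = sum (?f (Suc t)) (?H (Suc t))"
    by (simp add: bhattacharyya_def)
  \<comment> \<open>Some extensions are impossible in both models; including them only adds nonnegative
    terms and makes the index set a product.\<close>
  also have "\<dots> \<le> sum (?f (Suc t)) (?E ` (?H t \<times> ?A \<times> ?S))"
    using fin mmdp_histories_Suc_subset[OF assms]
    by (intro sum_mono2 finite_imageI finite_cartesian_product) (auto simp: history_prob_nonneg)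
  also have "\<dots> = (\<Sum>x\<in>?H t \<times> ?A \<times> ?S. ?f (Suc t) (?E x))"
    using sum.reindex[OF inj_on_subset[OF inj_extend_history subset_UNIV]] by simp
  also have "\<dots> = (\<Sum>h\<in>?H t. \<Sum>a\<in>?A. \<Sum>s\<in>?S. ?f (Suc t) (extend_history h a s))"
    by (simp add: sum.cartesian_product case_prod_unfold)
  also have "\<dots> \<le> (\<Sum>h\<in>?H t. ?f t h)"
    using fin by (intro sum_mono sum_extensions_le) (auto simp: mmdp_histories_def histories_def)
  finally show ?thesis
    by (simp add: bhattacharyya_def)
qed

theorem lemma2:
  fixes M\<^sub>1 M\<^sub>2 :: "('s, 'a) mdp" and \<pi> :: "('s, 'a) policy"
  assumes "binary_mmdp M\<^sub>1 M\<^sub>2"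
    and "is_policy M\<^sub>1 M\<^sub>2 \<pi>"
  shows "(\<forall>t. bhattacharyya M\<^sub>1 M\<^sub>2 \<pi> (t + 1) \<le> bhattacharyya M\<^sub>1 M\<^sub>2 \<pi> t) \<and>
         convergent (\<lambda>t. bhattacharyya M\<^sub>1 M\<^sub>2 \<pi> t)"
proof
  show "\<forall>t. bhattacharyya M\<^sub>1 M\<^sub>2 \<pi> (t + 1) \<le> bhattacharyya M\<^sub>1 M\<^sub>2 \<pi> t"
    using bhattacharyya_Suc_le[OF assms(1)] by simp
  have "decseq (bhattacharyya M\<^sub>1 M\<^sub>2 \<pi>)"
    using bhattacharyya_Suc_le[OF assms(1)] by (simp add: decseq_Suc_iff)
  moreover have "\<forall>t. 0 \<le> bhattacharyya M\<^sub>1 M\<^sub>2 \<pi> t"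
    unfolding bhattacharyya_def by (auto intro!: sum_nonneg simp: history_prob_nonneg)
  ultimately show "convergent (\<lambda>t. bhattacharyya M\<^sub>1 M\<^sub>2 \<pi> t)"
    by (metis decseq_convergent convergentI)
qed

end
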